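(* Let $\theta\in(0,\pi/2)$ and let $\mu$ be the probability measure on $\Omega=\{1,2\}^{\mathbb N}$ defined in the context. Let $p=\frac{1+\sin(2\theta)}{2}$. The only possible (convergent) values of $J$ are $p$ and $1-p=\frac{1-\sin(2\theta)}2$: if $x=(x_0,x_1,x_2,\dots)\in\Omega$ is such that the limit $$J(x)=\lim_{n\to\infty}\frac{\mu([x_0,\dots,x_n])}{\mu([x_1,\dots,x_n])}$$ is defined (all denominators positive) and exists, then $J(x)\in\{p,1-p\}$.
   Context: Let $\sigma^x=\begin{pmatrix}0&1\\1&0\end{pmatrix}$ and $H=\sigma^x\otimes\sigma^x$ acting on $\mathbb C^2\otimes\mathbb C^2$. For $n\ge 2$ let $H_n=\sum_{i=0}^{n-2}I^{\otimes i}\otimes H\otimes I^{\otimes(n-i-2)}$ on $(\mathbb C^2)^{\otimes n}$. For $\theta\in(0,\pi/2)$ let $P_1,P_2$ be the orthogonal projections of $\mathbb C^2$ onto the lines spanned by $\psi_1=(\cos\theta,\sin\theta)$ and $\psi_2=(-\sin\theta,\cos\theta)$. For $\beta>0$ and $(j_1,\dots,j_n)\in\{1,2\}^n$ put $$\mu_{\beta,n}(j_1,\dots,j_n)=\frac{\mathrm{Tr}\big[e^{-\beta H_n}(P_{j_1}\otimes\cdots\otimes P_{j_n})\big]}{\mathrm{Tr}(e^{-\beta H_n})},\qquad \mu_{\infty,n}=\lim_{\beta\to+\infty}\mu_{\beta,n}.$$ $\mu$ is the unique Borel probability measure on $\Omega$ with $\mu([j_1,\dots,j_n])=\mu_{\infty,n}(j_1,\dots,j_n)$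 for all $n\ge2$, where $[j_1,\dots,j_n]$ is the cylinder of sequences whose first $n$ coordinates are $j_1,\dots,j_n$. *)

theory Defs
  imports "HOL-Probability.Probability_Measure" "Jordan_Normal_Form.Matrix"
begin

no_notation Finite_Cartesian_Product.vec_nth (infixl \<open>$\<close> 90)
no_notation Inner_Product.real_inner_class.inner (infix \<open>\<bullet>\<close> 70)

definition mat_trace :: "complex mat \<Rightarrow> complex" where
  "mat_trace A = (\<Sum>i<dim_row A. A $$ (i, i))"

(* Entrywise exponential series of a square matrix; every entry converges absolutely. *)
definition mat_exp :: "complex mat \<Rightarrow> complex mat" where
  "mat_exp A = mat (dim_row A) (dim_row A) (\<lambda>(i, j). \<Sum>k. (A ^\<^sub>m k) $$ (i, j) / fact k)"

(* Kronecker product: the basis vector e_i (x) e_k has index i * (dimension of second factor) + k. *)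
definition kron :: "complex mat \<Rightarrow> complex mat \<Rightarrow> complex mat"  (infixr \<open>\<otimes>\<^sub>K\<close> 70) where
  "A \<otimes>\<^sub>K B = mat (dim_row A * dim_row B) (dim_col A * dim_col B)
     (\<lambda>(i, j). A $$ (i div dim_row B, j div dim_col B) * B $$ (i mod dim_row B, j mod dim_col B))"

definition kron_list :: "complex mat list \<Rightarrow> complex mat" where
  "kron_list As = foldr (\<otimes>\<^sub>K) As (1\<^sub>m 1)"

definition kron_pow :: "complex mat \<Rightarrow> nat \<Rightarrow> complex mat" where
  "kron_pow A k = kron_list (replicate k A)"

(* Matrix of the orthogonal projection w \<mapsto> (<w, v> / <v, v>) v onto the line spanned by v \<noteq> 0;
   see line_proj_mult_vec. *)
definition line_proj :: "complex Matrix.vec \<Rightarrow> complex mat" where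
  "line_proj v = mat (dim_vec v) (dim_vec v) (\<lambda>(i, j). v $ i * cnj (v $ j) / (v \<bullet>c v))"

lemma line_proj_mult_vec:
  assumes "dim_vec w = dim_vec v"
  shows "line_proj v *\<^sub>v w = ((w \<bullet>c v) / (v \<bullet>c v)) \<cdot>\<^sub>v v"
  using assms
  by (intro eq_vecI)
    (auto simp: line_proj_def scalar_prod_def sum_distrib_left
      sum_divide_distrib[symmetric] mult_ac
      intro!: sum.cong)

definition sigma_x :: "complex mat" where
  "sigma_x = mat_of_rows_list 2 [[0, 1], [1, 0]]"

definition H_pair :: "complex mat" where
  "H_pair = sigma_x \<otimes>\<^sub>K sigma_x"

(* The sum over i = 0, ..., n - 2 is written entrywise, since matrices of unspecified dimension
   do not form an additive monoid. Intended for n \<ge> 2. *)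
definition hamiltonian :: "nat \<Rightarrow> complex mat" where
  "hamiltonian n = mat (2 ^ n) (2 ^ n)
     (\<lambda>(r, c). \<Sum>i\<le>n - 2. (kron_pow (1\<^sub>m 2) i \<otimes>\<^sub>K H_pair \<otimes>\<^sub>K kron_pow (1\<^sub>m 2) (n - i - 2)) $$ (r, c))"

definition psi1 :: "real \<Rightarrow> complex Matrix.vec" where
  "psi1 \<theta> = vec_of_list [complex_of_real (cos \<theta>), complex_of_real (sin \<theta>)]"

definition psi2 :: "real \<Rightarrow> complex Matrix.vec" where
  "psi2 \<theta> = vec_of_list [complex_of_real (- sin \<theta>), complex_of_real (cos \<theta>)]"

(* Only the labels 1 and 2 are meaningful. *)
definition proj_P :: "real \<Rightarrow> nat \<Rightarrow> complex mat" where
  "proj_P \<theta> j = (if j = 1 then line_proj (psi1 \<theta>) else line_proj (psi2 \<theta>))"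

(* A word (j_1, ..., j_n) is a list of length n. The weights are kept complex-valued. *)
definition gibbs_weight :: "real \<Rightarrow> real \<Rightarrow> nat list \<Rightarrow> complex" where
  "gibbs_weight \<theta> \<beta> js =
     (let E = mat_exp (complex_of_real (- \<beta>) \<cdot>\<^sub>m hamiltonian (length js))
      in mat_trace (E * kron_list (map (proj_P \<theta>) js)) / mat_trace E)"

definition ground_weight :: "real \<Rightarrow> nat list \<Rightarrow> complex" where
  "ground_weight \<theta> js = Lim at_top (\<lambda>\<beta>. gibbs_weight \<theta> \<beta> js)"

definition Omega :: "(nat \<Rightarrow> nat) set" where
  "Omega = {x. \<forall>i. x i \<in> {1, 2}}"

definition cylinder :: "nat list \<Rightarrow> (nat \<Rightarrow> nat) set" where
  "cylinder js = {x \<in> Omega. \<forall>i < length js. x i = js ! i}"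

(* The topology on nat \<Rightarrow> nat is the product of the discrete topologies, so the sigma-algebra below
   is the Borel sigma-algebra of the subspace Omega. *)
definition is_ground_measure :: "real \<Rightarrow> (nat \<Rightarrow> nat) measure \<Rightarrow> bool" where
  "is_ground_measure \<theta> \<mu> \<longleftrightarrow>
     prob_space \<mu> \<and> sets \<mu> = sets (restrict_space borel Omega) \<and>
     (\<forall>js. length js \<ge> 2 \<and> set js \<subseteq> {1, 2} \<longrightarrow>
        complex_of_real (measure \<mu> (cylinder js)) = ground_weight \<theta> js)"

end

theory Submission
  imports Defs
begin

text \<open>
  The Hadamard matrix turns \<open>\<sigma>\<^sup>x\<close> into \<open>diag(1, -1)\<close>, so its
  tensor power makes the Hamiltonian diagonal: on the basis vector labelled by a word of \<open>n\<close>
  bits the energy is that of the antiferromagnetic Ising chain, the sum of \<open>\<plusminus>1\<close>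
  over neighbouring bits, with sign \<open>+1\<close> when they agree
  (\<open>hamiltonian_diagonalised\<close>). In the same basis the diagonal entries of
  \<open>P\<^sub>j\<^sub>1 \<otimes> \<dots> \<otimes> P\<^sub>j\<^sub>n\<close> are products
  of single-site numbers, each equal to \<open>p\<close> or \<open>1 - p\<close>
  (\<open>hadamard_proj_P_diag\<close>). A Gibbs weight is therefore a Boltzmann average of such products
  over all bit words (\<open>gibbs_weight_ising\<close>).

  As \<open>\<beta> \<rightarrow> \<infinity>\<close> only the words of least energy survive, and these
  are the two alternating ones. With \<open>f\<^sub>i\<close> the factor at site \<open>i\<close> for one of
  them, the factor for the other is \<open>1 - f\<^sub>i\<close>, whence
  \<open>\<mu>[j\<^sub>0, \<dots>, j\<^sub>n] = (\<Prod>f\<^sub>i + \<Prod>(1 - f\<^sub>i)) / 2\<close>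
  (\<open>measure_cylinder\<close>): \<open>\<mu>\<close> is an even mixture of two product measures.

  Removing the first letter of \<open>x\<close> shifts all sites by one, which exchanges the two alternating
  words and leaves the average unchanged. With \<open>A = f\<^sub>1 \<cdots> f\<^sub>n\<close>,
  \<open>B = (1 - f\<^sub>1) \<cdots> (1 - f\<^sub>n)\<close> and the posterior weight
  \<open>t = A / (A + B)\<close> of the first component, the quotient in question is thus
  \<open>f\<^sub>0 t + (1 - f\<^sub>0) (1 - t)\<close>. Since \<open>sin (2\<theta>) > 0\<close>, both
  \<open>p\<close> and \<open>1 - p\<close> differ from \<open>1/2\<close>, so the quotient converges only
  if \<open>t\<close> does. But \<open>t\<close> evolves by Bayes' rule with likelihoods \<open>p\<close> and
  \<open>1 - p\<close>, whose only fixed points are \<open>0\<close> and \<open>1\<close>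
  (\<open>bayes_update_limit\<close>), and these give the limits \<open>1 - f\<^sub>0\<close> and \<open>f\<^sub>0\<close>.
\<close>

section \<open>Kronecker products\<close>

lemma sum_lessThan_mult:
  fixes f :: "nat \<Rightarrow> 'a::comm_monoid_add"
  shows "(\<Sum>i<m * n. f i) = (\<Sum>a<m. \<Sum>b<n. f (a * n + b))"
proof -
  have "(\<Sum>i<m * n. f i) = (\<Sum>a<m. sum f {a * n..<a * n + n})"
    by (simp add: sum.nat_group)
  also have "\<dots> = (\<Sum>a<m. \<Sum>b<n. f (a * n + b))"
  proof (rule sum.cong[OF refl])
    fix a
    show "sum f {a * n..<a * n + n} = (\<Sum>b<n. f (a * n + b))"
      using sum.shift_bounds_nat_ivl[of f 0 "a * n" n]
      by (simp add: lessThan_atLeast0 add.commute)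
  qed
  finally show ?thesis .
qed

lemma dim_kron [simp]:
  "dim_row (A \<otimes>\<^sub>K B) = dim_row A * dim_row B"
  "dim_col (A \<otimes>\<^sub>K B) = dim_col A * dim_col B"
  by (simp_all add: kron_def)

lemma index_kron:
  "i < dim_row A * dim_row B \<Longrightarrow> j < dim_col A * dim_col B \<Longrightarrow>
    (A \<otimes>\<^sub>K B) $$ (i, j)
      = A $$ (i div dim_row B, j div dim_col B) * B $$ (i mod dim_row B, j mod dim_col B)"
  by (simp add: kron_def)

lemma div_mod_less_mult:
  fixes i :: nat
  assumes "i < a * b"
  shows "i div b < a" "i mod b < b"
  using assms by (auto simp: less_mult_imp_div_less mult.commute intro!: mod_less_divisor gr0I)

text \<open>
  Writing the summation index as \<open>a * n + b\<close> separates the sum for the matrix product into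
  a sum over \<open>a\<close> for the first factors times a sum over \<open>b\<close> for the second.
\<close>

lemma kron_mult_kron:
  assumes "dim_col A = dim_row C" "dim_col B = dim_row D"
  shows "(A \<otimes>\<^sub>K B) * (C \<otimes>\<^sub>K D) = (A * C) \<otimes>\<^sub>K (B * D)"
proof (rule eq_matI)
  fix i j
  assume ij: "i < dim_row ((A * C) \<otimes>\<^sub>K (B * D))" "j < dim_col ((A * C) \<otimes>\<^sub>K (B * D))"
  note i = div_mod_less_mult[of i "dim_row A" "dim_row B"]
  note j = div_mod_less_mult[of j "dim_col C" "dim_col D"]
  have lt: "a * dim_row D + b < dim_row C * dim_row D" if "a < dim_row C" "b < dim_row D" for a b
  proof -
    have "a * dim_row D + b < Suc a * dim_row D" using that by simp
    also have "\<dots> \<le> dim_row C * dim_row D" using that by (intro mult_le_mono1) simp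
    finally show ?thesis .
  qed
  have "((A \<otimes>\<^sub>K B) * (C \<otimes>\<^sub>K D)) $$ (i, j)
      = (\<Sum>k<dim_row C * dim_row D. (A \<otimes>\<^sub>K B) $$ (i, k) * (C \<otimes>\<^sub>K D) $$ (k, j))"
    using ij assms by (simp add: scalar_prod_def lessThan_atLeast0)
  also have "\<dots> = (\<Sum>a<dim_row C. \<Sum>b<dim_row D.
      (A $$ (i div dim_row B, a) * C $$ (a, j div dim_col D))
        * (B $$ (i mod dim_row B, b) * D $$ (b, j mod dim_col D)))"
    unfolding sum_lessThan_mult using ij assms
    by (intro sum.cong refl) (simp add: index_kron lt mult_ac)
  also have "\<dots> = ((A * C) \<otimes>\<^sub>K (B * D)) $$ (i, j)"
    using ij i j assms
    by (simp add: index_kron scalar_prod_def lessThan_atLeast0 sum_product)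
  finally show "((A \<otimes>\<^sub>K B) * (C \<otimes>\<^sub>K D)) $$ (i, j) = ((A * C) \<otimes>\<^sub>K (B * D)) $$ (i, j)" .
qed (use assms in simp_all)

text \<open>
  Both sides split an index into the same three mixed-radix digits, read off in different orders.
\<close>

lemma kron_assoc: "(A \<otimes>\<^sub>K B) \<otimes>\<^sub>K C = A \<otimes>\<^sub>K B \<otimes>\<^sub>K C"
proof (rule eq_matI)
  fix i j
  assume ij: "i < dim_row (A \<otimes>\<^sub>K B \<otimes>\<^sub>K C)" "j < dim_col (A \<otimes>\<^sub>K B \<otimes>\<^sub>K C)"
  then have i: "i < dim_row A * dim_row B * dim_row C" "i < dim_row A * (dim_row B * dim_row C)"
    and j: "j < dim_col A * dim_col B * dim_col C" "j < dim_col A * (dim_col B * dim_col C)"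
    by (simp_all add: mult.assoc)
  have digit: "k div (b * c) = k div c div b" "k mod (b * c) div c = k div c mod b"
    "k mod (b * c) mod c = k mod c" for k b c :: nat
  proof -
    show "k div (b * c) = k div c div b" by (metis div_mult2_eq mult.commute)
    have "k mod (b * c) = c * (k div c mod b) + k mod c"
      using mod_mult2_eq[of k c b] by (simp add: mult.commute)
    then show "k mod (b * c) div c = k div c mod b" "k mod (b * c) mod c = k mod c"
      by (cases "c = 0"; simp)+
  qed
  show "((A \<otimes>\<^sub>K B) \<otimes>\<^sub>K C) $$ (i, j) = (A \<otimes>\<^sub>K B \<otimes>\<^sub>K C) $$ (i, j)"
    using i j div_mod_less_mult[OF i(1)] div_mod_less_mult[OF j(1)]
      div_mod_less_mult[OF i(2)] div_mod_less_mult[OF j(2)]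
    by (simp add: index_kron digit mult.assoc)
qed (simp_all add: mult.assoc)

lemma one_kron [simp]: "1\<^sub>m 1 \<otimes>\<^sub>K A = A"
  by (rule eq_matI) (auto simp: index_kron)

lemma one_kron_one [simp]: "1\<^sub>m m \<otimes>\<^sub>K 1\<^sub>m n = 1\<^sub>m (m * n)"
proof (rule eq_matI)
  fix i j assume "i < dim_row (1\<^sub>m (m * n) :: complex mat)" "j < dim_col (1\<^sub>m (m * n) :: complex mat)"
  then show "((1\<^sub>m m \<otimes>\<^sub>K 1\<^sub>m n) :: complex mat) $$ (i, j) = 1\<^sub>m (m * n) $$ (i, j)"
    using div_mod_less_mult[of i m n] div_mod_less_mult[of j m n]
    by (auto simp: index_kron) (metis div_mult_mod_eq)
qed simp_all

lemma kron_list_simps [simp]: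
  "kron_list [] = 1\<^sub>m 1"
  "kron_list (A # As) = A \<otimes>\<^sub>K kron_list As"
  by (simp_all add: kron_list_def)

lemma kron_list_append: "kron_list (As @ Bs) = kron_list As \<otimes>\<^sub>K kron_list Bs"
  by (induction As) (simp_all add: kron_assoc del: One_nat_def)

lemma kron_list_carrier:
  assumes "set As \<subseteq> carrier_mat 2 2"
  shows "kron_list As \<in> carrier_mat (2 ^ length As) (2 ^ length As)"
  using assms by (induction As) auto

lemma kron_list_mult:
  assumes "length As = length Bs" "set As \<subseteq> carrier_mat 2 2" "set Bs \<subseteq> carrier_mat 2 2"
  shows "kron_list As * kron_list Bs = kron_list (map2 (*) As Bs)"
  using assms
proof (induction As Bs rule: list_induct2)
  case (Cons A As B Bs)
  then show ?case
    using kron_list_carrier[of As] kron_list_carrier[of Bs]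
    by (subst (1 2) kron_list_simps, subst kron_mult_kron) auto
qed simp

lemma kron_list_replicate_one: "kron_list (replicate n (1\<^sub>m 2)) = 1\<^sub>m (2 ^ n)"
  by (induction n) simp_all

section \<open>Binary digits as indices of tensor products\<close>

text \<open>
  Digits are listed from the most significant one, matching the convention that the first Kronecker
  factor selects the block.
\<close>

fun binary_digits :: "nat \<Rightarrow> nat \<Rightarrow> nat list" where
  "binary_digits 0 s = []"
| "binary_digits (Suc n) s = s div 2 ^ n # binary_digits n (s mod 2 ^ n)"

lemma length_binary_digits [simp]: "length (binary_digits n s) = n"
  by (induction n arbitrary: s) simp_all

abbreviation bit_words :: "nat \<Rightarrow> nat list set" where
  "bit_words n \<equiv> {w. set w \<subseteq> {0, 1} \<and> length w = n}"

lemma nth_bit_word: "w \<in> bit_words n \<Longrightarrow> i < n \<Longrightarrow> w ! i \<in> {0, 1}"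
  using nth_mem[of i w] by blast

lemma binary_digits_bit_word: "s < 2 ^ n \<Longrightarrow> binary_digits n s \<in> bit_words n"
proof (induction n arbitrary: s)
  case (Suc n)
  have "s div 2 ^ n < 2" using Suc.prems by (simp add: less_mult_imp_div_less)
  then show ?case using Suc.IH[of "s mod 2 ^ n"] by auto
qed simp

lemma binary_digits_inj:
  "s < 2 ^ n \<Longrightarrow> t < 2 ^ n \<Longrightarrow> binary_digits n s = binary_digits n t \<Longrightarrow> s = t"
proof (induction n arbitrary: s t)
  case (Suc n)
  then have "s div 2 ^ n = t div 2 ^ n" "s mod 2 ^ n = t mod 2 ^ n" by auto
  then show ?case by (metis div_mult_mod_eq)
qed simp

lemma bij_betw_binary_digits: "bij_betw (binary_digits n) {..<2 ^ n} (bit_words n)"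
proof -
  have inj: "inj_on (binary_digits n) {..<2 ^ n}"
    using binary_digits_inj by (auto simp: inj_on_def)
  moreover have "binary_digits n ` {..<2 ^ n} = bit_words n"
  proof (rule card_subset_eq)
    show "finite (bit_words n)" by (simp add: finite_lists_length_eq)
    show "binary_digits n ` {..<2 ^ n} \<subseteq> bit_words n"
      using binary_digits_bit_word by blast
    have "card (bit_words n) = 2 ^ n"
      using card_lists_length_eq[of "{0, 1 :: nat}" n] by (simp add: numeral_2_eq_2)
    then show "card (binary_digits n ` {..<2 ^ n}) = card (bit_words n)"
      using card_image[OF inj] by simp
  qed
  ultimately show ?thesis by (simp add: bij_betw_def)
qed

lemma index_kron_list:
  assumes "set As \<subseteq> carrier_mat 2 2" "length As = n" "r < 2 ^ n" "c < 2 ^ n"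
  shows "kron_list As $$ (r, c)
    = (\<Prod>i<n. (As ! i) $$ (binary_digits n r ! i, binary_digits n c ! i))"
  using assms
proof (induction As arbitrary: n r c)
  case (Cons A As)
  define m where "m = length As"
  have "kron_list As \<in> carrier_mat (2 ^ m) (2 ^ m)"
    using kron_list_carrier[of As] Cons.prems by (simp add: m_def)
  moreover have "n = Suc m" using Cons.prems by (simp add: m_def)
  ultimately show ?case
    using Cons.prems Cons.IH[of m "r mod 2 ^ m" "c mod 2 ^ m"]
    by (auto simp: index_kron m_def prod.lessThan_Suc_shift simp del: prod.lessThan_Suc)
qed simp

section \<open>Exponential and trace of a diagonalisable matrix\<close>

lemma index_diag_sandwich:
  fixes U V :: "complex mat"
  assumes "U \<in> carrier_mat n n" "V \<in> carrier_mat n n" "i < n" "j < n"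
  shows "(U * mat_diag n f * V) $$ (i, j) = (\<Sum>s<n. U $$ (i, s) * f s * V $$ (s, j))"
  using assms by (simp add: mat_diag_mult_right[of U n n] scalar_prod_def lessThan_atLeast0)

lemma mat_diag_pow: "mat_diag n d ^\<^sub>m k = mat_diag n (\<lambda>s. (d s :: complex) ^ k)"
proof (induction k)
  case 0
  then show ?case by (simp add: carrier_matD(1)[OF mat_diag_dim])
next
  case (Suc k)
  then show ?case by (simp add: mult.commute)
qed

text \<open>
  Powers of a conjugate are conjugates of powers, so the entrywise exponential series splits into
  finitely many scalar exponential series, one for each eigenvalue.
\<close>

lemma mat_exp_diagonalised:
  assumes A: "A \<in> carrier_mat n n" and sim: "similar_mat_wit A (mat_diag n d) U V"
  shows "mat_exp A = U * mat_diag n (\<lambda>s. exp (d s)) * V"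
proof (rule eq_matI)
  have UV: "U \<in> carrier_mat n n" "V \<in> carrier_mat n n"
    using similar_mat_witD2[OF A sim] by auto
  have dims: "dim_row A = n" "dim_row U = n" "dim_col V = n" using A UV by auto
  fix i j assume "i < dim_row (U * mat_diag n (\<lambda>s. exp (d s)) * V)"
    "j < dim_col (U * mat_diag n (\<lambda>s. exp (d s)) * V)"
  then have ij: "i < n" "j < n" by (simp_all add: dims)
  have "(\<lambda>k. U $$ (i, s) * (d s ^ k /\<^sub>R fact k) * V $$ (s, j))
      sums (U $$ (i, s) * exp (d s) * V $$ (s, j))" for s
    by (intro sums_mult sums_mult2 exp_converges)
  then have "(\<lambda>k. \<Sum>s<n. U $$ (i, s) * (d s ^ k /\<^sub>R fact k) * V $$ (s, j))
      sums (\<Sum>s<n. U $$ (i, s) * exp (d s) * V $$ (s, j))"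
    by (intro sums_sum)
  moreover have "(\<Sum>s<n. U $$ (i, s) * (d s ^ k /\<^sub>R fact k) * V $$ (s, j))
      = (A ^\<^sub>m k) $$ (i, j) / fact k" for k
    unfolding similar_mat_wit_pow_id[OF sim] mat_diag_pow index_diag_sandwich[OF UV ij]
    by (simp add: sum_distrib_left scaleR_conv_of_real divide_inverse mult_ac)
  ultimately show "mat_exp A $$ (i, j) = (U * mat_diag n (\<lambda>s. exp (d s)) * V) $$ (i, j)"
    unfolding index_diag_sandwich[OF UV ij] using ij
    by (simp add: mat_exp_def dims sums_iff)
qed (use A similar_mat_witD2[OF A sim] in \<open>auto simp: mat_exp_def\<close>)

lemma mat_trace_mult_comm:
  assumes "A \<in> carrier_mat m n" "B \<in> carrier_mat n m"
  shows "mat_trace (A * B) = mat_trace (B * A)"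
proof -
  have "mat_trace (A * B) = (\<Sum>i<m. \<Sum>j<n. A $$ (i, j) * B $$ (j, i))"
    using assms by (simp add: mat_trace_def scalar_prod_def lessThan_atLeast0)
  also have "\<dots> = (\<Sum>j<n. \<Sum>i<m. B $$ (j, i) * A $$ (i, j))"
    by (subst sum.swap) (simp add: mult.commute)
  also have "\<dots> = mat_trace (B * A)"
    using assms by (simp add: mat_trace_def scalar_prod_def lessThan_atLeast0)
  finally show ?thesis .
qed

text \<open>
  Cyclicity of the trace moves the change of basis from the exponential onto the observable; only the
  diagonal of the transformed observable then meets the diagonal exponential.
\<close>

lemma mat_trace_mat_exp_mult:
  assumes A: "A \<in> carrier_mat n n" and sim: "similar_mat_wit A (mat_diag n d) U V"
    and B: "B \<in> carrier_mat n n"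
  shows "mat_trace (mat_exp A * B) = (\<Sum>s<n. exp (d s) * (V * B * U) $$ (s, s))"
proof -
  have UV: "U \<in> carrier_mat n n" "V \<in> carrier_mat n n"
    using similar_mat_witD2[OF A sim] by auto
  let ?E = "mat_diag n (\<lambda>s. exp (d s))"
  have E: "?E \<in> carrier_mat n n" by simp
  note assoc = assoc_mult_mat[of _ n n _ n _ n]
  have "mat_trace (mat_exp A * B) = mat_trace (U * (?E * (V * B)))"
    unfolding mat_exp_diagonalised[OF A sim] using UV B E
    by (simp add: assoc assoc[OF _ mult_carrier_mat[OF E UV(2)] B])
  also have "\<dots> = mat_trace (?E * (V * B) * U)"
    using UV B E by (intro mat_trace_mult_comm[of _ n n] mult_carrier_mat[of _ n n])
  also have "?E * (V * B) * U = ?E * (V * B * U)"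
    using UV B E by (simp add: assoc)
  also have "mat_trace \<dots> = (\<Sum>s<n. exp (d s) * (V * B * U) $$ (s, s))"
    using UV B mult_carrier_mat[of "V * B" n n U n] mult_carrier_mat[of V n n B n]
    by (subst mat_diag_mult_left[of _ n n]) (auto simp: mat_trace_def)
  finally show ?thesis .
qed

lemma mat_trace_mat_exp:
  assumes A: "A \<in> carrier_mat n n" and sim: "similar_mat_wit A (mat_diag n d) U V"
  shows "mat_trace (mat_exp A) = (\<Sum>s<n. exp (d s))"
proof -
  have UV: "U \<in> carrier_mat n n" "V \<in> carrier_mat n n" "V * U = 1\<^sub>m n"
    using similar_mat_witD2[OF A sim] by auto
  have "mat_exp A \<in> carrier_mat n n" using A by (auto simp: mat_exp_def)
  then have "mat_trace (mat_exp A) = mat_trace (mat_exp A * 1\<^sub>m n)" by simp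
  also have "\<dots> = (\<Sum>s<n. exp (d s))"
    using UV by (subst mat_trace_mat_exp_mult[OF A sim]) simp_all
  finally show ?thesis .
qed

section \<open>The Hadamard basis\<close>

lemma sum_atLeast0LessThan_two: "(\<Sum>i = 0..<2. f i) = f 0 + f (1 :: nat)"
  by (simp add: numeral_2_eq_2)

definition hadamard :: "complex mat" where
  "hadamard = mat 2 2 (\<lambda>(i, j). (- 1) ^ (i * j) / complex_of_real (sqrt 2))"

lemma hadamard_carrier [simp]: "hadamard \<in> carrier_mat 2 2"
  by (simp add: hadamard_def)

lemma of_real_sqrt_two_square: "complex_of_real (sqrt 2) * complex_of_real (sqrt 2) = 2"
  by (metis of_real_mult of_real_numeral real_sqrt_mult_self abs_numeral)

lemma hadamard_square: "hadamard * hadamard = 1\<^sub>m 2"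
  by (rule eq_matI)
    (auto simp: hadamard_def scalar_prod_def sum_atLeast0LessThan_two less_2_cases_iff
      of_real_sqrt_two_square)

lemma hadamard_sigma_x: "hadamard * mat_diag 2 (\<lambda>b. (- 1) ^ b) * hadamard = sigma_x"
proof (rule eq_matI)
  fix i j assume "i < dim_row sigma_x" "j < dim_col sigma_x"
  then have "i < 2" "j < 2" by (simp_all add: sigma_x_def mat_of_rows_list_def)
  then show "(hadamard * mat_diag 2 (\<lambda>b. (- 1) ^ b) * hadamard) $$ (i, j) = sigma_x $$ (i, j)"
    unfolding index_diag_sandwich[OF hadamard_carrier hadamard_carrier \<open>i < 2\<close> \<open>j < 2\<close>]
      lessThan_atLeast0 sum_atLeast0LessThan_two
    by (elim less_2_cases[THEN disjE])
      (simp_all add: hadamard_def sigma_x_def mat_of_rows_list_def of_real_sqrt_two_square)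
qed (simp_all add: hadamard_def sigma_x_def mat_of_rows_list_def)

lemma hadamard_sandwich_diag:
  assumes "A \<in> carrier_mat 2 2" "b < 2"
  shows "(hadamard * A * hadamard) $$ (b, b)
    = (A $$ (0, 0) + (- 1) ^ b * (A $$ (0, 1) + A $$ (1, 0)) + A $$ (1, 1)) / 2"
proof -
  define h e where "h = 1 / complex_of_real (sqrt 2)" and "e = (- 1 :: complex) ^ b"
  have squares: "h * h = 1 / 2" "e * e = 1"
    by (simp_all add: h_def e_def of_real_sqrt_two_square flip: power_add)
  have entries: "hadamard $$ (0, b) = h" "hadamard $$ (1, b) = e * h"
    "hadamard $$ (b, 0) = h" "hadamard $$ (b, 1) = e * h"
    using assms by (simp_all add: hadamard_def h_def e_def)
  have "(hadamard * A * hadamard) $$ (b, b)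
      = (h * A $$ (0, 0) + e * h * A $$ (1, 0)) * h + (h * A $$ (0, 1) + e * h * A $$ (1, 1)) * (e * h)"
    using assms carrier_matD[OF assms(1)] carrier_matD[OF hadamard_carrier]
    by (simp add: scalar_prod_def sum_atLeast0LessThan_two entries entries[unfolded One_nat_def])
  also have "\<dots> = h * h * (A $$ (0, 0) + e * (A $$ (0, 1) + A $$ (1, 0)) + e * e * A $$ (1, 1))"
    by (simp only: algebra_simps)
  finally show ?thesis by (simp only: squares e_def) simp
qed

text \<open>
  Tensor powers of the Hadamard matrix are the normalised Walsh matrices. They are involutions,
  so the same matrix serves for the change of basis and for its inverse.
\<close>

definition walsh :: "nat \<Rightarrow> complex mat" where
  "walsh n = kron_list (replicate n hadamard)"

lemma walsh_carrier [simp]: "walsh n \<in> carrier_mat (2 ^ n) (2 ^ n)"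
  using kron_list_carrier[of "replicate n hadamard"]
  by (auto simp: walsh_def set_replicate_conv_if)

lemma walsh_sandwich:
  assumes "set As \<subseteq> carrier_mat 2 2" "length As = n"
  shows "walsh n * kron_list As * walsh n = kron_list (map (\<lambda>A. hadamard * A * hadamard) As)"
proof -
  have "walsh n * kron_list As = kron_list (map (\<lambda>A. hadamard * A) As)"
    unfolding walsh_def using assms
    by (subst kron_list_mult) (auto simp: zip_replicate1 set_replicate_conv_if comp_def)
  also have "\<dots> * walsh n = kron_list (map (\<lambda>A. hadamard * A * hadamard) As)"
    unfolding walsh_def using assms
    by (subst kron_list_mult) (auto simp: zip_replicate2 set_replicate_conv_if comp_def
        intro!: mult_carrier_mat[of _ 2 2])
  finally show ?thesis .
qed

lemma walsh_square: "walsh n * walsh n = 1\<^sub>m (2 ^ n)"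
  unfolding walsh_def
  by (subst kron_list_mult)
    (auto simp: zip_replicate1 set_replicate_conv_if hadamard_square kron_list_replicate_one)

text \<open>
  An off-diagonal entry vanishes because two different indices differ in some binary digit, where the
  corresponding diagonal factor contributes 0.
\<close>

lemma kron_list_mat_diag:
  "kron_list (map (mat_diag 2) fs)
    = mat_diag (2 ^ length fs) (\<lambda>s. \<Prod>i<length fs. (fs ! i) (binary_digits (length fs) s ! i))"
    (is "_ = mat_diag (2 ^ ?n) _")
proof (rule eq_matI)
  fix r c assume "r < dim_row (mat_diag (2 ^ ?n) (\<lambda>s. \<Prod>i<?n. (fs ! i) (binary_digits ?n s ! i)))"
    "c < dim_col (mat_diag (2 ^ ?n) (\<lambda>s. \<Prod>i<?n. (fs ! i) (binary_digits ?n s ! i)))"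
  then have rc: "r < 2 ^ ?n" "c < 2 ^ ?n" by (simp_all add: mat_diag_def)
  have digit: "binary_digits ?n s ! i < 2" if "i < ?n" "s < 2 ^ ?n" for i s
    using nth_bit_word[OF binary_digits_bit_word[OF that(2)] that(1)] by auto
  have "kron_list (map (mat_diag 2) fs) $$ (r, c)
      = (\<Prod>i<?n. mat_diag 2 (fs ! i) $$ (binary_digits ?n r ! i, binary_digits ?n c ! i))"
    using rc by (subst index_kron_list[where n = ?n]) auto
  also have "\<dots> = (\<Prod>i<?n. if binary_digits ?n r ! i = binary_digits ?n c ! i
      then (fs ! i) (binary_digits ?n c ! i) else 0)"
    using rc digit by (intro prod.cong) (auto simp: mat_diag_def)
  also have "\<dots> = (if r = c then \<Prod>i<?n. (fs ! i) (binary_digits ?n c ! i) else 0)"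
  proof (cases "r = c")
    case False
    then obtain i where "i < ?n" "binary_digits ?n r ! i \<noteq> binary_digits ?n c ! i"
      using binary_digits_inj[OF rc] nth_equalityI[of "binary_digits ?n r" "binary_digits ?n c"]
      by auto
    then show ?thesis using False by (auto intro!: prod_zero)
  qed simp
  finally show "kron_list (map (mat_diag 2) fs) $$ (r, c) = mat_diag (2 ^ ?n)
      (\<lambda>s. \<Prod>i<?n. (fs ! i) (binary_digits ?n s ! i)) $$ (r, c)"
    using rc by (simp add: mat_diag_def)
qed (use kron_list_carrier[of "map (mat_diag 2) fs"] in
    \<open>auto simp: image_subset_iff carrier_matD[OF mat_diag_dim]\<close>)

section \<open>The Hamiltonian as an Ising chain\<close>

definition bond_sign :: "nat list \<Rightarrow> nat \<Rightarrow> real" where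
  "bond_sign w i = (- 1) ^ (w ! i) * (- 1) ^ (w ! Suc i)"

definition ising_energy :: "nat list \<Rightarrow> real" where
  "ising_energy w = (\<Sum>i<length w - 1. bond_sign w i)"

text \<open>
  As \<open>\<sigma>\<^sup>x\<close> is the Hadamard conjugate of \<open>diag(1, -1)\<close> and the
  identity is its own conjugate, one bond term is the Walsh conjugate of a product of diagonal matrices,
  of which only those at sites \<open>i\<close> and \<open>i + 1\<close> are not the identity.
\<close>

lemma bond_term_diagonalised:
  assumes "i + 2 \<le> n"
  shows "kron_pow (1\<^sub>m 2) i \<otimes>\<^sub>K H_pair \<otimes>\<^sub>K kron_pow (1\<^sub>m 2) (n - i - 2)
    = walsh n * mat_diag (2 ^ n) (\<lambda>s. complex_of_real (bond_sign (binary_digits n s) i)) * walsh n"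
proof -
  define z :: "nat \<Rightarrow> complex" where "z = (\<lambda>b. (- 1) ^ b)"
  define fs where
    "fs = replicate i (\<lambda>_. 1) @ [z, z] @ replicate (n - i - 2) (\<lambda>_. 1 :: complex)"
  have len: "length fs = n" using assms by (simp add: fs_def)
  have "kron_pow (1\<^sub>m 2) i \<otimes>\<^sub>K H_pair \<otimes>\<^sub>K kron_pow (1\<^sub>m 2) (n - i - 2)
      = kron_list (replicate i (1\<^sub>m 2) @ [sigma_x, sigma_x] @ replicate (n - i - 2) (1\<^sub>m 2))"
    by (simp add: kron_pow_def H_pair_def kron_list_append kron_assoc)
  also have "\<dots> = kron_list (map (\<lambda>A. hadamard * A * hadamard) (map (mat_diag 2) fs))"
    by (simp add: fs_def z_def hadamard_sigma_x hadamard_square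
        right_mult_one_mat[OF hadamard_carrier])
  also have "\<dots> = walsh n * kron_list (map (mat_diag 2) fs) * walsh n"
    using len by (subst walsh_sandwich) auto
  also have "kron_list (map (mat_diag 2) fs)
      = mat_diag (2 ^ n) (\<lambda>s. \<Prod>k<n. (fs ! k) (binary_digits n s ! k))"
    by (simp add: kron_list_mat_diag len)
  also have "(\<lambda>s. \<Prod>k<n. (fs ! k) (binary_digits n s ! k))
      = (\<lambda>s. complex_of_real (bond_sign (binary_digits n s) i))"
  proof
    fix s
    have "(\<Prod>k<n. (fs ! k) (binary_digits n s ! k))
        = (\<Prod>k\<in>{i, Suc i}. (fs ! k) (binary_digits n s ! k))"
      using assms by (intro prod.mono_neutral_right) (auto simp: fs_def nth_append nth_Cons')
    also have "\<dots> = complex_of_real (bond_sign (binary_digits n s) i)"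
      by (simp add: fs_def nth_append bond_sign_def z_def)
    finally show "(\<Prod>k<n. (fs ! k) (binary_digits n s ! k))
        = complex_of_real (bond_sign (binary_digits n s) i)" .
  qed
  finally show ?thesis .
qed

lemma hamiltonian_diagonalised:
  assumes "n \<ge> 2"
  shows "similar_mat_wit (hamiltonian n)
    (mat_diag (2 ^ n) (\<lambda>s. complex_of_real (ising_energy (binary_digits n s)))) (walsh n) (walsh n)"
proof (rule similar_mat_witI[OF walsh_square walsh_square])
  let ?D = "mat_diag (2 ^ n) (\<lambda>s. complex_of_real (ising_energy (binary_digits n s)))"
  show "hamiltonian n = walsh n * ?D * walsh n"
  proof (rule eq_matI)
    fix r c assume "r < dim_row (walsh n * ?D * walsh n)" "c < dim_col (walsh n * ?D * walsh n)"
    then have rc: "r < 2 ^ n" "c < 2 ^ n" using walsh_carrier[of n] by auto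
    have range: "{..n - 2} = {..<n - 1}" using assms by auto
    have "hamiltonian n $$ (r, c) = (\<Sum>i<n - 1.
        (kron_pow (1\<^sub>m 2) i \<otimes>\<^sub>K H_pair \<otimes>\<^sub>K kron_pow (1\<^sub>m 2) (n - i - 2)) $$ (r, c))"
      using rc by (simp add: hamiltonian_def range)
    also have "\<dots> = (\<Sum>i<n - 1. \<Sum>s<2 ^ n. walsh n $$ (r, s)
        * complex_of_real (bond_sign (binary_digits n s) i) * walsh n $$ (s, c))"
    proof (intro sum.cong[OF refl])
      fix i assume "i \<in> {..<n - 1}"
      then have "i + 2 \<le> n" by auto
      then show "(kron_pow (1\<^sub>m 2) i \<otimes>\<^sub>K H_pair \<otimes>\<^sub>K kron_pow (1\<^sub>m 2) (n - i - 2)) $$ (r, c)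
          = (\<Sum>s<2 ^ n. walsh n $$ (r, s) * complex_of_real (bond_sign (binary_digits n s) i)
            * walsh n $$ (s, c))"
        by (simp only: bond_term_diagonalised
            index_diag_sandwich[OF walsh_carrier walsh_carrier rc])
    qed
    also have "\<dots> = (walsh n * ?D * walsh n) $$ (r, c)"
      unfolding index_diag_sandwich[OF walsh_carrier walsh_carrier rc]
      by (subst sum.swap) (simp add: ising_energy_def sum_distrib_left sum_distrib_right)
    finally show "hamiltonian n $$ (r, c) = (walsh n * ?D * walsh n) $$ (r, c)" .
  qed (simp_all add: hamiltonian_def carrier_matD[OF walsh_carrier])
qed (auto simp: hamiltonian_def)

section \<open>Diagonal entries of the projections\<close>

text \<open>
  For \<open>p = (1 + sin (2\<theta>)) / 2\<close> this is
  \<open>\<bar>\<langle>\<psi>\<^sub>j, h\<^sub>b\<rangle>\<bar>\<^sup>2\<close>, where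
  \<open>h\<^sub>0\<close> and \<open>h\<^sub>1\<close> are the columns of the Hadamard matrix.
  Flipping the label or the bit exchanges \<open>p\<close> and \<open>1 - p\<close>.
\<close>

definition overlap :: "real \<Rightarrow> nat \<Rightarrow> nat \<Rightarrow> real" where
  "overlap p j b = (if j = 1 \<longleftrightarrow> b = 0 then p else 1 - p)"

lemma line_proj_carrier: "dim_vec v = n \<Longrightarrow> line_proj v \<in> carrier_mat n n"
  by (auto simp: line_proj_def)

lemma proj_P_carrier [simp]: "proj_P \<theta> j \<in> carrier_mat 2 2"
  by (simp add: proj_P_def psi1_def psi2_def line_proj_carrier)

lemma line_proj_unit_pair:
  assumes "a\<^sup>2 + b\<^sup>2 = 1"
  shows "line_proj (vec_of_list [complex_of_real a, complex_of_real b])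
    = mat 2 2 (\<lambda>(i, j). complex_of_real ([a, b] ! i * [a, b] ! j))"
proof -
  let ?v = "vec_of_list [complex_of_real a, complex_of_real b]"
  have dim: "dim_vec ?v = 2" by simp
  have "?v \<bullet>c ?v = complex_of_real (a\<^sup>2 + b\<^sup>2)"
    by (simp add: scalar_prod_def power2_eq_square)
  then have "?v \<bullet>c ?v = 1" by (simp only: assms of_real_1)
  with dim have proj: "line_proj ?v = mat 2 2 (\<lambda>(i, j). ?v $ i * cnj (?v $ j))"
    by (simp only: line_proj_def div_by_1)
  show ?thesis
  proof (rule eq_matI)
    fix i j
    assume "i < dim_row (mat 2 2 (\<lambda>(i, j). complex_of_real ([a, b] ! i * [a, b] ! j)))"
      "j < dim_col (mat 2 2 (\<lambda>(i, j). complex_of_real ([a, b] ! i * [a, b] ! j)))"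
    then have "i < 2" "j < 2" by simp_all
    then show "line_proj ?v $$ (i, j)
        = mat 2 2 (\<lambda>(i, j). complex_of_real ([a, b] ! i * [a, b] ! j)) $$ (i, j)"
      unfolding proj by (elim less_2_cases[THEN disjE]) simp_all
  qed (simp_all add: line_proj_def)
qed

text \<open>
  For a unit vector \<open>(u, v)\<close> the entry is
  \<open>(u \<plusminus> v)\<^sup>2 / 2 = (1 \<plusminus> 2uv) / 2\<close>, and \<open>2uv\<close> is
  \<open>sin (2\<theta>)\<close> for \<open>\<psi>\<^sub>1\<close> and its negative for
  \<open>\<psi>\<^sub>2\<close>.
\<close>

lemma hadamard_proj_P_diag:
  assumes "b < 2"
  shows "(hadamard * proj_P \<theta> j * hadamard) $$ (b, b)
    = complex_of_real (overlap ((1 + sin (2 * \<theta>)) / 2) j b)"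
proof -
  define u v where "u = (if j = 1 then cos \<theta> else - sin \<theta>)"
    and "v = (if j = 1 then sin \<theta> else cos \<theta>)"
  have unit: "u\<^sup>2 + v\<^sup>2 = 1" by (simp add: u_def v_def)
  have uv: "2 * u * v = (if j = 1 then sin (2 * \<theta>) else - sin (2 * \<theta>))"
    by (simp add: u_def v_def sin_double)
  have P: "proj_P \<theta> j = mat 2 2 (\<lambda>(i, j). complex_of_real ([u, v] ! i * [u, v] ! j))"
    unfolding line_proj_unit_pair[OF unit, symmetric]
    by (simp add: proj_P_def psi1_def psi2_def u_def v_def)
  have "(hadamard * proj_P \<theta> j * hadamard) $$ (b, b)
      = complex_of_real ((u\<^sup>2 + v\<^sup>2 + (- 1) ^ b * (2 * u * v)) / 2)"
    unfolding hadamard_sandwich_diag[OF proj_P_carrier assms]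
    by (simp add: P power2_eq_square algebra_simps)
  also have "\<dots> = complex_of_real (overlap ((1 + sin (2 * \<theta>)) / 2) j b)"
    unfolding unit uv using assms by (auto simp: overlap_def less_2_cases_iff field_simps)
  finally show ?thesis .
qed

section \<open>Gibbs weights and their low-temperature limit\<close>

lemma smult_mat_diag: "c \<cdot>\<^sub>m mat_diag n d = mat_diag n (\<lambda>s. (c :: complex) * d s)"
  by (rule eq_matI) (auto simp: mat_diag_def)

text \<open>
  The partition function and the unnormalised weight are both traces against the same exponential, so
  one diagonalisation evaluates them; reading the row index in binary turns the sum over indices into a
  sum over spin configurations.
\<close>

lemma gibbs_weight_ising:
  assumes "length js = n" "n \<ge> 2"
  shows "gibbs_weight \<theta> \<beta> js = complex_of_real
    ((\<Sum>w\<in>bit_words n. exp (- \<beta> * ising_energy w)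
        * (\<Prod>i<n. overlap ((1 + sin (2 * \<theta>)) / 2) (js ! i) (w ! i)))
      / (\<Sum>w\<in>bit_words n. exp (- \<beta> * ising_energy w)))"
proof -
  define p where "p = (1 + sin (2 * \<theta>)) / 2"
  define A where "A = complex_of_real (- \<beta>) \<cdot>\<^sub>m hamiltonian n"
  define d where "d = (\<lambda>s. complex_of_real (- \<beta> * ising_energy (binary_digits n s)))"
  define B where "B = kron_list (map (proj_P \<theta>) js)"
  have A: "A \<in> carrier_mat (2 ^ n) (2 ^ n)" by (simp add: A_def hamiltonian_def)
  have B: "B \<in> carrier_mat (2 ^ n) (2 ^ n)"
    using kron_list_carrier[of "map (proj_P \<theta>) js"] assms by (auto simp: B_def image_subset_iff)
  have sim: "similar_mat_wit A (mat_diag (2 ^ n) d) (walsh n) (walsh n)"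
    using similar_mat_wit_smult[OF hamiltonian_diagonalised[OF assms(2)],
        of "complex_of_real (- \<beta>)"]
    by (simp add: A_def d_def smult_mat_diag)
  have exp_d: "exp (d s) = complex_of_real (exp (- \<beta> * ising_energy (binary_digits n s)))" for s
    by (simp only: d_def exp_of_real)
  have "exp (d s) * (walsh n * B * walsh n) $$ (s, s)
      = complex_of_real (exp (- \<beta> * ising_energy (binary_digits n s))
        * (\<Prod>i<n. overlap p (js ! i) (binary_digits n s ! i)))" if "s < 2 ^ n" for s
  proof -
    define Cs where "Cs = map (\<lambda>j. hadamard * proj_P \<theta> j * hadamard) js"
    have Cs: "set Cs \<subseteq> carrier_mat 2 2" "length Cs = n"
      using assms(1) by (auto simp: Cs_def intro!: mult_carrier_mat[of _ 2 2])
    have bit: "binary_digits n s ! i < 2" if "i < n" for i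
      using nth_bit_word[OF binary_digits_bit_word[OF \<open>s < 2 ^ n\<close>] that] by auto
    have "walsh n * B * walsh n = kron_list Cs"
      unfolding B_def using assms by (subst walsh_sandwich) (auto simp: Cs_def comp_def)
    then have "(walsh n * B * walsh n) $$ (s, s)
        = (\<Prod>i<n. (Cs ! i) $$ (binary_digits n s ! i, binary_digits n s ! i))"
      using index_kron_list[OF Cs that that] by simp
    also have "\<dots> = complex_of_real (\<Prod>i<n. overlap p (js ! i) (binary_digits n s ! i))"
      using bit assms(1) by (simp add: hadamard_proj_P_diag p_def Cs_def)
    finally show ?thesis by (simp only: exp_d of_real_mult)
  qed
  then have "mat_trace (mat_exp A * B) = complex_of_real
      (\<Sum>s<2 ^ n. exp (- \<beta> * ising_energy (binary_digits n s))
        * (\<Prod>i<n. overlap p (js ! i) (binary_digits n s ! i)))"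
    by (simp add: mat_trace_mat_exp_mult[OF A sim B])
  also have "(\<Sum>s<2 ^ n. exp (- \<beta> * ising_energy (binary_digits n s))
        * (\<Prod>i<n. overlap p (js ! i) (binary_digits n s ! i)))
      = (\<Sum>w\<in>bit_words n. exp (- \<beta> * ising_energy w) * (\<Prod>i<n. overlap p (js ! i) (w ! i)))"
    by (rule sum.reindex_bij_betw[OF bij_betw_binary_digits])
  finally have numerator: "mat_trace (mat_exp A * B) = complex_of_real
      (\<Sum>w\<in>bit_words n. exp (- \<beta> * ising_energy w) * (\<Prod>i<n. overlap p (js ! i) (w ! i)))" .
  have "mat_trace (mat_exp A)
      = complex_of_real (\<Sum>s<2 ^ n. exp (- \<beta> * ising_energy (binary_digits n s)))"
    by (simp add: mat_trace_mat_exp[OF A sim] exp_d)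
  also have "(\<Sum>s<2 ^ n. exp (- \<beta> * ising_energy (binary_digits n s)))
      = (\<Sum>w\<in>bit_words n. exp (- \<beta> * ising_energy w))"
    by (rule sum.reindex_bij_betw[OF bij_betw_binary_digits])
  finally show ?thesis
    using numerator assms(1) by (simp add: gibbs_weight_def Let_def A_def B_def p_def)
qed

text \<open>
  Multiplying numerator and denominator by \<open>e\<^sup>\<beta>\<^sup>m\<close> leaves the quotient
  unchanged and makes every Boltzmann factor converge: to 1 at minimal energy, to 0 elsewhere.
\<close>

lemma boltzmann_average_tendsto:
  fixes E g :: "'a \<Rightarrow> real"
  assumes "finite S" and least: "\<And>w. w \<in> S \<Longrightarrow> m \<le> E w"
    and M: "M = {w \<in> S. E w = m}" "M \<noteq> {}"
  shows "((\<lambda>\<beta>. (\<Sum>w\<in>S. exp (- \<beta> * E w) * g w) / (\<Sum>w\<in>S. exp (- \<beta> * E w)))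
    \<longlongrightarrow> (\<Sum>w\<in>M. g w) / card M) at_top"
proof -
  have gap: "((\<lambda>\<beta>. exp (- \<beta> * (E w - m))) \<longlongrightarrow> (if w \<in> M then 1 else 0)) at_top"
    if "w \<in> S" for w
  proof (cases "w \<in> M")
    case False
    then have "E w - m > 0" using least[OF that] that M by auto
    then have "((\<lambda>\<beta>. exp (- \<beta> * (E w - m))) \<longlongrightarrow> 0) at_top" by real_asymp
    with False show ?thesis by simp
  qed (use M in simp)
  have restrict: "(\<Sum>w\<in>S. (if w \<in> M then 1 else 0) * h w) = (\<Sum>w\<in>M. h w)"
    for h :: "'a \<Rightarrow> real"
    using assms by (intro sum.mono_neutral_cong_right) auto
  have "((\<lambda>\<beta>. \<Sum>w\<in>S. exp (- \<beta> * (E w - m)) * g w) \<longlongrightarrow> (\<Sum>w\<in>M. g w)) at_top"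
    unfolding restrict[of g, symmetric] by (intro tendsto_intros gap)
  moreover have "((\<lambda>\<beta>. \<Sum>w\<in>S. exp (- \<beta> * (E w - m)) * 1) \<longlongrightarrow> (\<Sum>w\<in>M. 1)) at_top"
    unfolding restrict[of "\<lambda>_. 1", symmetric] by (intro tendsto_intros gap)
  moreover have "finite M" using assms by simp
  ultimately have "((\<lambda>\<beta>. (\<Sum>w\<in>S. exp (- \<beta> * (E w - m)) * g w)
      / (\<Sum>w\<in>S. exp (- \<beta> * (E w - m)) * 1)) \<longlongrightarrow> (\<Sum>w\<in>M. g w) / card M) at_top"
    using M(2) by (auto intro!: tendsto_divide)
  moreover have "(\<Sum>w\<in>S. exp (- \<beta> * (E w - m)) * g w) / (\<Sum>w\<in>S. exp (- \<beta> * (E w - m)) * 1)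
      = (\<Sum>w\<in>S. exp (- \<beta> * E w) * g w) / (\<Sum>w\<in>S. exp (- \<beta> * E w))" for \<beta>
  proof -
    have shift: "(\<Sum>w\<in>S. exp (- \<beta> * (E w - m)) * h w)
        = exp (\<beta> * m) * (\<Sum>w\<in>S. exp (- \<beta> * E w) * h w)" for h :: "'a \<Rightarrow> real"
    proof -
      have "exp (- \<beta> * (E w - m)) = exp (\<beta> * m) * exp (- \<beta> * E w)" for w
        by (simp add: algebra_simps flip: exp_add)
      then show ?thesis by (simp add: sum_distrib_left mult.assoc)
    qed
    show ?thesis unfolding shift by simp
  qed
  ultimately show ?thesis by (simp only:)
qed

definition alternating_word :: "nat \<Rightarrow> nat \<Rightarrow> nat list" where
  "alternating_word b n = map (\<lambda>i. (b + i) mod 2) [0..<n]"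

lemma bond_sign_cases:
  assumes "w \<in> bit_words n" "Suc i < n"
  shows "bond_sign w i = (if w ! i = w ! Suc i then 1 else - 1)"
proof -
  have "w ! i \<in> {0, 1}" "w ! Suc i \<in> {0, 1}"
    using nth_bit_word[OF assms(1)] assms(2) by simp_all
  then show ?thesis by (auto simp: bond_sign_def)
qed

lemma ising_energy_ge:
  assumes "w \<in> bit_words n"
  shows "- real (n - 1) \<le> ising_energy w"
proof -
  have "(\<Sum>i<n - 1. - 1) \<le> (\<Sum>i<n - 1. bond_sign w i)"
    using bond_sign_cases[OF assms] by (intro sum_mono) auto
  then show ?thesis using assms by (simp add: ising_energy_def)
qed

text \<open>
  The lower bound on the energy is attained only if every bond contributes \<open>-1\<close>, that is, if
  neighbouring bits always differ; such a word is determined by its first bit.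
\<close>

lemma ising_ground_states:
  assumes "n \<ge> 1"
  shows "{w \<in> bit_words n. ising_energy w = - real (n - 1)}
    = {alternating_word 0 n, alternating_word 1 n}"
proof (intro equalityI subsetI)
  fix w assume "w \<in> {w \<in> bit_words n. ising_energy w = - real (n - 1)}"
  then have w: "w \<in> bit_words n" "(\<Sum>i<n - 1. bond_sign w i + 1) = 0"
    by (auto simp: ising_energy_def sum.distrib)
  have "\<forall>i\<in>{..<n - 1}. bond_sign w i + 1 = 0"
  proof (rule sum_nonneg_eq_0_iff[THEN iffD1])
    show "0 \<le> bond_sign w i + 1" if "i \<in> {..<n - 1}" for i
      using bond_sign_cases[OF w(1), of i] that by simp
  qed (use w(2) in simp_all)
  then have zero: "bond_sign w i + 1 = 0" if "Suc i < n" for i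
    using that by simp
  have flip: "w ! Suc i \<noteq> w ! i" if "Suc i < n" for i
    using zero[OF that] bond_sign_cases[OF w(1) that] by auto
  note bit = nth_bit_word[OF w(1)]
  have "w ! i = (w ! 0 + i) mod 2" if "i < n" for i
    using that
  proof (induction i)
    case 0
    then show ?case using bit[of 0] by auto
  next
    case (Suc i)
    then have "w ! i = (w ! 0 + i) mod 2" "w ! Suc i \<noteq> w ! i" "w ! Suc i \<in> {0, 1}"
      using flip[of i] bit[of "Suc i"] by simp_all
    then show ?case by (auto simp: mod_Suc)
  qed
  then have "w = alternating_word (w ! 0) n"
    using w(1) by (auto simp: alternating_word_def intro!: nth_equalityI)
  then show "w \<in> {alternating_word 0 n, alternating_word 1 n}"
    using bit[of 0] assms by auto
next
  fix w assume "w \<in> {alternating_word 0 n, alternating_word 1 n}"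
  then obtain b where b: "w = alternating_word b n" by auto
  have bits: "w \<in> bit_words n" by (auto simp: b alternating_word_def)
  have "bond_sign w i = - 1" if "i < n - 1" for i
  proof -
    have "Suc i < n" using that by simp
    then have "w ! i \<noteq> w ! Suc i" by (simp add: b alternating_word_def mod_Suc)
    then show ?thesis using bond_sign_cases[OF bits \<open>Suc i < n\<close>] by simp
  qed
  then have "ising_energy w = - real (n - 1)" using bits by (simp add: ising_energy_def)
  with bits show "w \<in> {w \<in> bit_words n. ising_energy w = - real (n - 1)}" by blast
qed

lemma ground_weight_eq:
  assumes "length js = n" "n \<ge> 2" "p = (1 + sin (2 * \<theta>)) / 2"
  shows "ground_weight \<theta> js = complex_of_real
    (((\<Prod>i<n. overlap p (js ! i) (i mod 2)) + (\<Prod>i<n. overlap p (js ! i) (Suc i mod 2))) / 2)"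
proof -
  let ?g = "\<lambda>w. \<Prod>i<n. overlap p (js ! i) (w ! i)"
  let ?M = "{alternating_word 0 n, alternating_word 1 n}"
  have "alternating_word 0 n ! 0 \<noteq> alternating_word 1 n ! 0"
    using assms(2) by (simp add: alternating_word_def)
  then have distinct: "alternating_word 0 n \<noteq> alternating_word 1 n" by metis
  have "((\<lambda>\<beta>. (\<Sum>w\<in>bit_words n. exp (- \<beta> * ising_energy w) * ?g w)
      / (\<Sum>w\<in>bit_words n. exp (- \<beta> * ising_energy w))) \<longlongrightarrow> (\<Sum>w\<in>?M. ?g w) / card ?M) at_top"
  proof (rule boltzmann_average_tendsto)
    show "finite (bit_words n)" by (simp add: finite_lists_length_eq)
    show "?M = {w \<in> bit_words n. ising_energy w = - real (n - 1)}"
      using ising_ground_states[of n] assms(2) by simp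
  qed (simp_all only: ising_energy_ge insert_not_empty not_False_eq_True)
  then have "((\<lambda>\<beta>. gibbs_weight \<theta> \<beta> js)
      \<longlongrightarrow> complex_of_real ((\<Sum>w\<in>?M. ?g w) / card ?M)) at_top"
    unfolding gibbs_weight_ising[OF assms(1,2)] assms(3)[symmetric] by (rule tendsto_of_real)
  then have "ground_weight \<theta> js = complex_of_real ((\<Sum>w\<in>?M. ?g w) / card ?M)"
    unfolding ground_weight_def by (intro tendsto_Lim trivial_limit_at_top_linorder)
  also have "(\<Sum>w\<in>?M. ?g w) / card ?M
      = ((\<Prod>i<n. overlap p (js ! i) (i mod 2)) + (\<Prod>i<n. overlap p (js ! i) (Suc i mod 2))) / 2"
    using distinct by (simp add: alternating_word_def)
  finally show ?thesis .
qed

lemma measure_cylinder: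
  assumes "is_ground_measure \<theta> \<mu>" "p = (1 + sin (2 * \<theta>)) / 2"
    and "length js = n" "n \<ge> 2" "set js \<subseteq> {1, 2}"
  shows "measure \<mu> (cylinder js)
    = ((\<Prod>i<n. overlap p (js ! i) (i mod 2)) + (\<Prod>i<n. overlap p (js ! i) (Suc i mod 2))) / 2"
proof -
  have "complex_of_real (measure \<mu> (cylinder js)) = ground_weight \<theta> js"
    using assms by (simp add: is_ground_measure_def)
  then show ?thesis unfolding ground_weight_eq[OF assms(3,4,2)] by (simp only: of_real_eq_iff)
qed

section \<open>Limits of Bayesian updates\<close>

text \<open>
  If \<open>t\<close> is the posterior probability of one of two hypotheses, and the next observation has
  likelihood \<open>f\<close> under it and \<open>1 - f\<close> under the other, then the assumption is
  Bayes' rule with the denominator cleared, so that no case with denominator 0 arises. Passing to the limit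
  with a constant likelihood \<open>c\<close> would give
  \<open>l * (1 - l) * (1 - 2 * c) = 0\<close>. Here the likelihood may keep switching between
  \<open>p\<close> and \<open>1 - p\<close>; the product of the two defects vanishes in either case.
\<close>

lemma bayes_update_limit:
  fixes t f :: "nat \<Rightarrow> real"
  assumes update: "\<forall>\<^sub>F n in sequentially. t (Suc n) * (t n * f n + (1 - t n) * (1 - f n)) = t n * f n"
    and f: "\<And>n. f n \<in> {p, 1 - p}" and "p \<noteq> 1 / 2" and lim: "t \<longlonglongrightarrow> l"
  shows "l \<in> {0, 1}"
proof -
  define defect where "defect c n = t (Suc n) * (t n * c + (1 - t n) * (1 - c)) - t n * c" for c n
  have "defect c \<longlonglongrightarrow> l * (l * c + (1 - l) * (1 - c)) - l * c" for c
    unfolding defect_def by (intro tendsto_intros lim LIMSEQ_Suc)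
  moreover have "l * (l * c + (1 - l) * (1 - c)) - l * c = l * (1 - l) * (1 - 2 * c)" for c
    by (simp add: algebra_simps)
  ultimately have "defect c \<longlonglongrightarrow> l * (1 - l) * (1 - 2 * c)" for c by simp
  then have "(\<lambda>n. defect p n * defect (1 - p) n)
      \<longlonglongrightarrow> (l * (1 - l) * (1 - 2 * p)) * (l * (1 - l) * (1 - 2 * (1 - p)))"
    by (intro tendsto_mult)
  moreover have "\<forall>\<^sub>F n in sequentially. defect p n * defect (1 - p) n = 0"
    using update
  proof eventually_elim
    case (elim n)
    then have "defect (f n) n = 0" by (simp add: defect_def)
    then show ?case using f[of n] by auto
  qed
  then have "(\<lambda>n. defect p n * defect (1 - p) n) \<longlonglongrightarrow> 0" by (rule tendsto_eventually)
  ultimately have "(l * (1 - l) * (1 - 2 * p)) * (l * (1 - l) * (1 - 2 * (1 - p))) = 0"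
    by (rule LIMSEQ_unique)
  then show ?thesis using \<open>p \<noteq> 1 / 2\<close> by auto
qed

lemma overlap_flip: "overlap p j (Suc i mod 2) = 1 - overlap p j (i mod 2)"
  by (auto simp: overlap_def mod_Suc)

theorem proposition24:
  fixes \<theta> p J :: real and \<mu> :: "(nat \<Rightarrow> nat) measure" and x :: "nat \<Rightarrow> nat"
  assumes "0 < \<theta>" and "\<theta> < pi / 2"
    and "is_ground_measure \<theta> \<mu>"
    and "p = (1 + sin (2 * \<theta>)) / 2"
    and "x \<in> Omega"
    and "\<And>n. measure \<mu> (cylinder (map x [1..<Suc n])) > 0"
    and "(\<lambda>n. measure \<mu> (cylinder (map x [0..<Suc n]))
              / measure \<mu> (cylinder (map x [1..<Suc n]))) \<longlonglongrightarrow> J"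
  shows "J \<in> {p, 1 - p}"
proof -
  define f where "f i = overlap p (x i) (i mod 2)" for i
  define A where "A n = (\<Prod>i<n. f (Suc i))" for n
  define B where "B n = (\<Prod>i<n. 1 - f (Suc i))" for n
  define t where "t n = A n / (A n + B n)" for n
  have f: "f i \<in> {p, 1 - p}" for i by (simp add: f_def overlap_def)
  have x: "x i \<in> {1, 2}" for i using assms(5) by (auto simp: Omega_def)
  have words: "set (map x is) \<subseteq> {1, 2}" for "is" using x by auto
  have "sin (2 * \<theta>) > 0" using assms(1,2) by (intro sin_gt_zero) auto
  then have p: "p \<noteq> 1 / 2" using assms(4) by simp
  \<comment> \<open>The formula for cylinders needs words of length at least 2; shorter words affect only
    finitely many terms of the sequence.\<close>
  have long: "measure \<mu> (cylinder (map x [0..<Suc n])) = (f 0 * A n + (1 - f 0) * B n) / 2"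
    if "n \<ge> 2" for n
  proof -
    have "measure \<mu> (cylinder (map x [0..<Suc n]))
        = ((\<Prod>i<Suc n. f i) + (\<Prod>i<Suc n. 1 - f i)) / 2"
      using that
      by (subst measure_cylinder[OF assms(3,4) _ _ words, of _ "Suc n"])
        (simp_all add: overlap_flip f_def del: upt_Suc prod.lessThan_Suc)
    then show ?thesis by (simp only: A_def B_def prod.lessThan_Suc_shift)
  qed
  have short: "measure \<mu> (cylinder (map x [1..<Suc n])) = (A n + B n) / 2" if "n \<ge> 2" for n
  proof -
    \<comment> \<open>Site \<open>i\<close> of the shortened word carries the letter \<open>x (Suc i)\<close>, so
      the parity of the site is off by one and the two products trade places.\<close>
    have "overlap p (x (Suc i)) (i mod 2) = 1 - f (Suc i)" for i
      unfolding f_def overlap_flip by simp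
    then show ?thesis
      using that
      by (subst measure_cylinder[OF assms(3,4) _ _ words, of _ n])
        (simp_all add: A_def B_def overlap_flip del: upt_Suc)
  qed
  have pos: "A n + B n > 0" if "n \<ge> 2" for n
    using assms(6)[of n] short[OF that] by simp
  have "\<forall>\<^sub>F n in sequentially. t (Suc n) * (t n * f (Suc n) + (1 - t n) * (1 - f (Suc n)))
      = t n * f (Suc n)"
    using eventually_ge_at_top[of 2]
  proof eventually_elim
    case (elim n)
    have step: "A (Suc n) = A n * f (Suc n)" "B (Suc n) = B n * (1 - f (Suc n))"
      by (simp_all add: A_def B_def)
    have "1 - t n = B n / (A n + B n)"
      using pos[OF elim] by (simp add: t_def field_simps)
    then have "t n * f (Suc n) + (1 - t n) * (1 - f (Suc n)) = (A (Suc n) + B (Suc n)) / (A n + B n)"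
      by (simp add: t_def step add_divide_distrib)
    then show ?case
      using pos[of "Suc n"] elim by (simp add: t_def step)
  qed
  moreover have "t \<longlonglongrightarrow> (J - (1 - f 0)) / (2 * f 0 - 1)"
  proof (rule Lim_transform_eventually)
    let ?J = "\<lambda>n. measure \<mu> (cylinder (map x [0..<Suc n])) / measure \<mu> (cylinder (map x [1..<Suc n]))"
    show "(\<lambda>n. (?J n - (1 - f 0)) / (2 * f 0 - 1)) \<longlonglongrightarrow> (J - (1 - f 0)) / (2 * f 0 - 1)"
      using f[of 0] p by (intro tendsto_intros assms(7)) auto
    show "\<forall>\<^sub>F n in sequentially. (?J n - (1 - f 0)) / (2 * f 0 - 1) = t n"
      using eventually_ge_at_top[of 2]
    proof eventually_elim
      case (elim n)
      have "?J n - (1 - f 0) = (2 * f 0 - 1) * t n"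
        using pos[OF elim] unfolding long[OF elim] short[OF elim] t_def
        by (simp add: field_simps)
      moreover have "2 * f 0 - 1 \<noteq> 0" using f[of 0] p by auto
      ultimately show ?case by simp
    qed
  qed
  ultimately have "(J - (1 - f 0)) / (2 * f 0 - 1) \<in> {0, 1}"
    using bayes_update_limit[of t "\<lambda>n. f (Suc n)" p] f p by blast
  then have "J = f 0 \<or> J = 1 - f 0"
    using f[of 0] p by (auto simp: field_simps)
  then show ?thesis using f[of 0] by auto
qed

end
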